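(* Let $\eta_t=\eta t^{-\alpha}$ for $t\ge1$ with $\eta>0$, $\alpha\in(1/2,1)$. Fix $p>2$ and $q\in[1,p/2]$, and suppose $$\frac{p-2}{2(p+1)}<\frac{1-\alpha}{2}.$$ Then one can construct a class $\mathfrak C_{\mathrm{osc}}$ of stochastic oracles whose dynamics satisfy conditions (A1)–(A5) of the context uniformly over the class. Moreover, there exist constants $c>0$ and $T_0<\infty$ such that, for every integer $T\ge T_0$, $$\mathcal D_T(\mathfrak C_{\mathrm{osc}})\ge c\,T^{-\frac{p-2}{2(p+1)}}.$$
   Context: Stochastic oracle. A (scalar) stochastic oracle is a tuple $\mathcal M=(g_{\mathcal M},(\epsilon_t^{\mathcal M})_{t\ge1},(\mathcal F_t^{\mathcal M})_{t\ge0},\mathbb P_{\mathcal M})$ where $g_{\mathcal M}:\mathbb R\to\mathbb R$ is a mean field with root $x^\star=0$ and $(\epsilon_t^{\mathcal M})$ is a martingale-difference sequence adapted to $(\mathcal F_t^{\mathcal M})$ under $\mathbb P_{\mathcal M}$ (expectation $\mathbb E_{\mathcal M}$). Its dynamics are $x_1^{\mathcal M}=0$, $x_{t+1}^{\mathcal M}=x_t^{\mathcal M}-\eta_tg_{\mathcal M}(x_t^{\mathcal M})+\eta_t\epsilon_t^{\mathcal M}$. The path $\Phi_T^{\mathcal M}:[0,1]\to\mathbb R$ has $\Phi_T^{\mathcal M}(n/T)=T^{-1/2}\sum_{t=1}^nx_{t+1}^{\mathcal M}$, $0\le n\le T$, and is linearly interpolated in between. Conditions (with $x^\star=0$). (A1)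 For some $G_{\mathcal M}>0$, $\delta_g>0$, $C_{\mathrm{sm}},C_{\mathrm{bd}}<\infty$: $|g_{\mathcal M}(x)-G_{\mathcal M}x|\le C_{\mathrm{sm}}x^2$ for $|x|\le\delta_g$ and $\sup_{x\in\mathbb R}|g_{\mathcal M}(x)-G_{\mathcal M}x|\le C_{\mathrm{bd}}$. (A2) The step sizes are $\eta_t=\eta t^{-\alpha}$, $\eta>0$, $\alpha\in(1/2,1)$. (A3) For a deterministic $M_p<\infty$, a.s. for all $t\ge1$: $\mathbb E_{\mathcal M}[\epsilon_t^{\mathcal M}\mid\mathcal F_{t-1}^{\mathcal M}]=0$ and $\mathbb E_{\mathcal M}[|\epsilon_t^{\mathcal M}|^p\mid\mathcal F_{t-1}^{\mathcal M}]\le M_p$. (A4) For some $S_{\mathcal M}\ge0$ (the limiting variance), $C_S<\infty$ and exponent $\gamma>0$, for every integer $m\ge2$: $\mathbb E_{\mathcal M}\big[\max_{0\le n\le m}\big|\frac1m\sum_{t=1}^n\mathbb E_{\mathcal M}[(\epsilon_t^{\mathcal M})^2\mid\mathcal F_{t-1}^{\mathcal M}]-\frac nmS_{\mathcal M}\big|\big]\le C_Sm^{-3\gamma}$. (A5) For some $C_\Delta<\infty$: $\mathbb E_{\mathcal M}[|x_t^{\mathcal M}|^{2q}]\le C_\Delta\eta_t^q$ for every $t\ge1$. "Uniformly over the class" means that the constants $\delta_g,C_{\mathrm{sm}},C_{\mathrm{bd}},M_p,C_S,\gamma,C_\Delta$ can be chosen the same for all oracles of the class. Target and worst-case error. $Z^{\mathcal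 M}=G_{\mathcal M}^{-1}S_{\mathcal M}^{1/2}W_\star^{(1)}$ with $W_\star^{(1)}$ a standard one-dimensional Brownian motion on $[0,1]$, and, for a nonempty class $\mathfrak C$ of oracles, $\mathcal D_T(\mathfrak C)=\sup_{\mathcal M\in\mathfrak C}d_{\mathrm P}(\Phi_T^{\mathcal M},Z^{\mathcal M})$. Metrics. With $\Lambda$ the set of strictly increasing continuous bijections of $[0,1]$ onto itself, for càdlàg $f,h\in D([0,1],\mathbb R)$: $d_{\mathrm S}(f,h)=\inf_{\lambda\in\Lambda}\{\sup_{0\le s<t\le1}|\log\frac{\lambda(t)-\lambda(s)}{t-s}|\vee\sup_{r}|f(\lambda(r))-h(r)|\}$. $d_{\mathrm P}(\mu,\nu)$ is the infimum of $\delta>0$ such that $\mu(\Gamma)\le\nu(\Gamma^\delta)+\delta$ and $\nu(\Gamma)\le\mu(\Gamma^\delta)+\delta$ for every Borel $\Gamma\subset(D([0,1],\mathbb R),d_{\mathrm S})$, where $\Gamma^\delta=\{h:\inf_{f\in\Gamma}d_{\mathrm S}(f,h)<\delta\}$; for random elements it is applied to their laws. *)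

theory Defs
  imports "HOL-Probability.Probability"
begin

section \<open>Stochastic oracles\<close>

record 'w sgd_oracle =
  mean_field :: "real \<Rightarrow> real"
  noise :: "nat \<Rightarrow> 'w \<Rightarrow> real"
  filtr :: "nat \<Rightarrow> 'w measure"
  prob_measure :: "'w measure"

text \<open>
  The noise at time 0 is irrelevant. Borel measurability of the mean field is what makes the
  iterates random variables.
\<close>

definition stochastic_oracle :: "'w sgd_oracle \<Rightarrow> bool" where
  "stochastic_oracle M \<longleftrightarrow>
     prob_space (prob_measure M) \<and>
     mean_field M \<in> borel_measurable borel \<and>
     mean_field M 0 = 0 \<and>
     filtration (space (prob_measure M)) (filtr M) \<and>
     (\<forall>t. subalgebra (prob_measure M) (filtr M t)) \<and>
     (\<forall>t\<ge>1. noise M t \<in> borel_measurable (filtr M t)) \<and>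
     (\<forall>t\<ge>1. integrable (prob_measure M) (noise M t)) \<and>
     (\<forall>t\<ge>1. AE \<omega> in prob_measure M.
        real_cond_exp (prob_measure M) (filtr M (t - 1)) (noise M t) \<omega> = 0)"

definition step_size :: "real \<Rightarrow> real \<Rightarrow> nat \<Rightarrow> real" where
  "step_size \<eta> \<alpha> t = \<eta> * real t powr (- \<alpha>)"

text \<open>Iterates are indexed from 1; the value at index 0 is a dummy.\<close>

fun iterate :: "(nat \<Rightarrow> real) \<Rightarrow> 'w sgd_oracle \<Rightarrow> nat \<Rightarrow> 'w \<Rightarrow> real" where
  "iterate h M 0 \<omega> = 0"
| "iterate h M (Suc 0) \<omega> = 0"
| "iterate h M (Suc (Suc t)) \<omega> =
     iterate h M (Suc t) \<omega>
       - h (Suc t) * mean_field M (iterate h M (Suc t) \<omega>)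
       + h (Suc t) * noise M (Suc t) \<omega>"

definition partial_sum :: "(nat \<Rightarrow> real) \<Rightarrow> 'w sgd_oracle \<Rightarrow> 'w \<Rightarrow> nat \<Rightarrow> real" where
  "partial_sum h M \<omega> n = (\<Sum>t = 1..n. iterate h M (t + 1) \<omega>)"

definition sgd_path :: "(nat \<Rightarrow> real) \<Rightarrow> nat \<Rightarrow> 'w sgd_oracle \<Rightarrow> 'w \<Rightarrow> real \<Rightarrow> real" where
  "sgd_path h T M \<omega> = (\<lambda>u\<in>{0..1}.
     let n = nat \<lfloor>real T * u\<rfloor>; s = partial_sum h M \<omega>
     in (s n + (real T * u - real n) * (s (n + 1) - s n)) / sqrt (real T))"


section \<open>Conditions on stochastic oracles\<close>

definition mean_field_cond :: "real \<Rightarrow> real \<Rightarrow> real \<Rightarrow> real \<Rightarrow> 'w sgd_oracle \<Rightarrow> bool" where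
  "mean_field_cond \<delta>g Csm Cbd G M \<longleftrightarrow>
     G > 0 \<and>
     (\<forall>x. \<bar>x\<bar> \<le> \<delta>g \<longrightarrow> \<bar>mean_field M x - G * x\<bar> \<le> Csm * x\<^sup>2) \<and>
     (\<forall>x. \<bar>mean_field M x - G * x\<bar> \<le> Cbd)"

text \<open>
  Expectations of nonnegative quantities are taken in the extended nonnegative reals
  (\<^const>\<open>nn_cond_exp\<close>, \<^const>\<open>nn_integral\<close>), so that a bound on them includes finiteness; the
  real-valued versions return 0 for non-integrable arguments.
\<close>

definition noise_moment_cond :: "real \<Rightarrow> real \<Rightarrow> 'w sgd_oracle \<Rightarrow> bool" where
  "noise_moment_cond p Mp M \<longleftrightarrow>
     (AE \<omega> in prob_measure M. \<forall>t\<ge>1.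
        real_cond_exp (prob_measure M) (filtr M (t - 1)) (noise M t) \<omega> = 0 \<and>
        nn_cond_exp (prob_measure M) (filtr M (t - 1)) (\<lambda>\<omega>'. ennreal (\<bar>noise M t \<omega>'\<bar> powr p)) \<omega>
          \<le> ennreal Mp)"

text \<open>The noise is required to be square integrable, so the conditional variances are genuine.\<close>

definition noise_variance_cond :: "real \<Rightarrow> real \<Rightarrow> real \<Rightarrow> 'w sgd_oracle \<Rightarrow> bool" where
  "noise_variance_cond CS \<gamma> S M \<longleftrightarrow>
     S \<ge> 0 \<and>
     (\<forall>t\<ge>1. integrable (prob_measure M) (\<lambda>\<omega>. (noise M t \<omega>)\<^sup>2)) \<and>
     (\<forall>m::nat. m \<ge> 2 \<longrightarrow>
        (\<integral>\<^sup>+ \<omega>. ennreal (MAX n\<in>{0..m}.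
             \<bar>(1 / real m) * (\<Sum>t = 1..n. real_cond_exp (prob_measure M) (filtr M (t - 1))
                                              (\<lambda>\<omega>'. (noise M t \<omega>')\<^sup>2) \<omega>)
              - (real n / real m) * S\<bar>) \<partial>prob_measure M)
          \<le> ennreal (CS * real m powr (- 3 * \<gamma>)))"

definition iterate_moment_cond :: "(nat \<Rightarrow> real) \<Rightarrow> real \<Rightarrow> real \<Rightarrow> 'w sgd_oracle \<Rightarrow> bool" where
  "iterate_moment_cond h q C\<Delta> M \<longleftrightarrow>
     (\<forall>t\<ge>1. (\<integral>\<^sup>+ \<omega>. ennreal (\<bar>iterate h M t \<omega>\<bar> powr (2 * q)) \<partial>prob_measure M)
              \<le> ennreal (C\<Delta> * h t powr q))"

text \<open>
  The slope \<open>G M\<close> and the limiting variance \<open>S M\<close> are the only constants that may vary over the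
  class; each is uniquely determined by \<open>M\<close>, as the derivative of the mean field at 0 and the
  limit of the averaged conditional variances.
\<close>

definition uniform_conditions ::
  "(nat \<Rightarrow> real) \<Rightarrow> real \<Rightarrow> real \<Rightarrow> ('w sgd_oracle \<Rightarrow> real) \<Rightarrow> ('w sgd_oracle \<Rightarrow> real) \<Rightarrow> 'w sgd_oracle set \<Rightarrow> bool"
where
  "uniform_conditions h p q G S \<CC> \<longleftrightarrow>
     (\<exists>\<delta>g Csm Cbd Mp CS \<gamma> C\<Delta>. \<delta>g > 0 \<and> \<gamma> > 0 \<and>
        (\<forall>M\<in>\<CC>.
           mean_field_cond \<delta>g Csm Cbd (G M) M \<and> noise_moment_cond p Mp M \<and>
           noise_variance_cond CS \<gamma> (S M) M \<and> iterate_moment_cond h q C\<Delta> M))"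


section \<open>The Skorokhod space and the Prokhorov distance\<close>

definition skorokhod_space :: "(real \<Rightarrow> real) set" where
  "skorokhod_space = {f \<in> extensional {0..1}.
     (\<forall>t\<in>{0..<1}. continuous (at_right t) f) \<and>
     (\<forall>t\<in>{0<..1}. \<exists>l. (f \<longlongrightarrow> l) (at_left t))}"

definition time_changes :: "(real \<Rightarrow> real) set" where
  "time_changes = {\<theta>. strict_mono_on {0..1} \<theta> \<and> continuous_on {0..1} \<theta> \<and>
                      bij_betw \<theta> {0..1} {0..1}}"

text \<open>
  The distance takes values in \<^typ>\<open>ereal\<close> because the log-slope of a time change may be unbounded;
  the infimum is finite, as the identity is a time change.
\<close>

definition skorokhod_dist :: "(real \<Rightarrow> real) \<Rightarrow> (real \<Rightarrow> real) \<Rightarrow> ereal" where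
  "skorokhod_dist f h = (INF \<theta>\<in>time_changes.
     max (SUP (s, t)\<in>{(s, t). 0 \<le> s \<and> s < t \<and> t \<le> 1}. ereal \<bar>ln ((\<theta> t - \<theta> s) / (t - s))\<bar>)
         (SUP r\<in>{0..1}. ereal \<bar>f (\<theta> r) - h r\<bar>))"

definition skorokhod_open :: "(real \<Rightarrow> real) set \<Rightarrow> bool" where
  "skorokhod_open U \<longleftrightarrow> U \<subseteq> skorokhod_space \<and>
     (\<forall>f\<in>U. \<exists>r>0. \<forall>h\<in>skorokhod_space. skorokhod_dist f h < ereal r \<longrightarrow> h \<in> U)"

definition skorokhod_borel :: "(real \<Rightarrow> real) measure" where
  "skorokhod_borel = sigma skorokhod_space {U. skorokhod_open U}"

definition skorokhod_nbhd :: "(real \<Rightarrow> real) set \<Rightarrow> real \<Rightarrow> (real \<Rightarrow> real) set" where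
  "skorokhod_nbhd \<Gamma> \<delta> = {h \<in> skorokhod_space. (INF f\<in>\<Gamma>. skorokhod_dist f h) < ereal \<delta>}"

definition prokhorov_dist :: "(real \<Rightarrow> real) measure \<Rightarrow> (real \<Rightarrow> real) measure \<Rightarrow> ereal" where
  "prokhorov_dist \<mu> \<nu> = (INF \<delta>\<in>{\<delta>. \<delta> > 0 \<and>
     (\<forall>\<Gamma>\<in>sets skorokhod_borel.
        measure \<mu> \<Gamma> \<le> measure \<nu> (skorokhod_nbhd \<Gamma> \<delta>) + \<delta> \<and>
        measure \<nu> \<Gamma> \<le> measure \<mu> (skorokhod_nbhd \<Gamma> \<delta>) + \<delta>)}. ereal \<delta>)"


section \<open>The Gaussian target and the worst-case error\<close>

definition standard_brownian_motion :: "'b measure \<Rightarrow> (real \<Rightarrow> 'b \<Rightarrow> real) \<Rightarrow> bool" where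
  "standard_brownian_motion N W \<longleftrightarrow>
     prob_space N \<and>
     (\<forall>t\<in>{0..1}. W t \<in> borel_measurable N) \<and>
     (\<forall>\<omega>\<in>space N. W 0 \<omega> = 0) \<and>
     (\<forall>\<omega>\<in>space N. continuous_on {0..1} (\<lambda>t. W t \<omega>)) \<and>
     (\<forall>s t. 0 \<le> s \<and> s < t \<and> t \<le> 1 \<longrightarrow>
        distributed N lborel (\<lambda>\<omega>. W t \<omega> - W s \<omega>) (normal_density 0 (sqrt (t - s)))) \<and>
     (\<forall>(n::nat) \<tau>. strict_mono_on {..n} \<tau> \<and> \<tau> ` {..n} \<subseteq> {0..1} \<longrightarrow>
        prob_space.indep_vars N (\<lambda>_. borel) (\<lambda>i \<omega>. W (\<tau> (Suc i)) \<omega> - W (\<tau> i) \<omega>) {..<n})"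

definition target_path :: "(real \<Rightarrow> 'b \<Rightarrow> real) \<Rightarrow> real \<Rightarrow> real \<Rightarrow> 'b \<Rightarrow> real \<Rightarrow> real" where
  "target_path W g s \<omega> = (\<lambda>u\<in>{0..1}. inverse g * sqrt s * W u \<omega>)"

definition worst_case_error ::
  "'b measure \<Rightarrow> (real \<Rightarrow> 'b \<Rightarrow> real) \<Rightarrow> (nat \<Rightarrow> real) \<Rightarrow>
   ('w sgd_oracle \<Rightarrow> real) \<Rightarrow> ('w sgd_oracle \<Rightarrow> real) \<Rightarrow> nat \<Rightarrow> 'w sgd_oracle set \<Rightarrow> ereal"
where
  "worst_case_error N W h G S T \<CC> =
     (SUP M\<in>\<CC>. prokhorov_dist
        (distr (prob_measure M) skorokhod_borel (sgd_path h T M))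
        (distr N skorokhod_borel (target_path W (G M) (S M))))"

end

theory Submission
  imports Defs
begin

text \<open>
  The limiting variance may be zero. The target is then the zero path, whose law is a point mass, and
  the distance to it is at least \<open>r\<close> as soon as the normalised path has modulus at least \<open>r\<close> at time 1
  with probability at least \<open>r\<close> (\<open>prokhorov_dist_point_mass_ge\<close>). So a rare but large deviation of the
  path suffices, and the moment condition on the noise leaves room for one.

  Let the noise consist of at most one symmetric jump of size \<open>a\<close>, which occurs at each time in the
  first half of the horizon \<open>T\<close> with probability \<open>\<delta> / T\<close>. For the linear mean field \<open>x / \<eta>\<close>, the jump
  raises the sum of the iterates by about \<open>\<eta> * a\<close>, whenever it occurs: a later jump enters with a
  smaller step size but is forgotten more slowly, and these two effects cancel
  (\<open>sum_response_ge_half\<close>). After normalisation the path moves by the order of \<open>a / sqrt T\<close>. Choosing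
  \<open>a = \<delta> * sqrt T\<close> makes this the order of the probability \<open>\<delta>\<close> of a jump, and the \<open>p\<close>-th moment
  \<open>a powr p * \<delta> / T\<close> of the noise is 1 exactly for \<open>\<delta> = T powr (- \<beta>)\<close> with
  \<open>\<beta> = (p - 2) / (2 * (p + 1))\<close>, which is the asserted rate.

  The conditions hold uniformly in \<open>T\<close> for the following reasons. Half of the mass is on the path
  without a jump, so conditioning on the past at most doubles the moments of the noise
  (\<open>nn_cond_exp_noise_le\<close>); in particular the conditional variances are at most
  \<open>2 * a\<^sup>2 * \<delta> / T = 2 * T powr (- 3 * \<beta>)\<close>, which gives the variance condition with exponent \<open>\<gamma> = \<beta>\<close>.
  That exponent requires \<open>3 * \<beta> \<le> 1\<close> for averages over more than \<open>T\<close> steps, and this follows from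
  \<open>\<beta> < (1 - \<alpha>) / 2 < 1 / 4\<close>. For the moments of the iterates, a single jump means that at each time
  either the iterate or the next noise vanishes. So all absolute moments, and not only the second
  ones, satisfy a linear recursion (\<open>iterate_moment_recursion\<close>), whose solutions decay like powers of
  the step size (\<open>contraction_recursion_bound\<close>).
\<close>

section \<open>Distance from the law of a random path to the zero path\<close>

definition zero_path :: "real \<Rightarrow> real" where
  "zero_path = (\<lambda>u\<in>{0..1}. 0)"

lemma skorokhod_dist_zero_path_ge:
  assumes "u \<in> {0..1}"
  shows "ereal \<bar>h u\<bar> \<le> skorokhod_dist zero_path h"
  unfolding skorokhod_dist_def
proof (rule INF_greatest)
  fix \<theta> assume "\<theta> \<in> time_changes"
  then have "\<theta> u \<in> {0..1}"
    using assms unfolding time_changes_def by (blast dest: bij_betwE)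
  then have "zero_path (\<theta> u) = 0"
    by (simp add: zero_path_def)
  then have "ereal \<bar>h u\<bar> \<le> (SUP r\<in>{0..1}. ereal \<bar>zero_path (\<theta> r) - h r\<bar>)"
    using assms by (intro order_trans[OF _ SUP_upper[of u]]) simp_all
  then show "ereal \<bar>h u\<bar> \<le> max (SUP (s, t)\<in>{(s, t). 0 \<le> s \<and> s < t \<and> t \<le> 1}.
      ereal \<bar>ln ((\<theta> t - \<theta> s) / (t - s))\<bar>) (SUP r\<in>{0..1}. ereal \<bar>zero_path (\<theta> r) - h r\<bar>)"
    by (rule max.coboundedI2)
qed

lemma skorokhod_dist_to_zero_path_ge:
  assumes "u \<in> {0..1}"
  shows "ereal \<bar>f u\<bar> \<le> skorokhod_dist f zero_path"
  unfolding skorokhod_dist_def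
proof (rule INF_greatest)
  fix \<theta> assume "\<theta> \<in> time_changes"
  then have "\<theta> ` {0..1} = {0..1}"
    by (simp add: time_changes_def bij_betw_def)
  then obtain r where r: "r \<in> {0..1}" "\<theta> r = u"
    using assms by (metis imageE)
  then have "ereal \<bar>f u\<bar> \<le> (SUP r\<in>{0..1}. ereal \<bar>f (\<theta> r) - zero_path r\<bar>)"
    by (intro order_trans[OF _ SUP_upper[of r]]) (simp_all add: zero_path_def)
  then show "ereal \<bar>f u\<bar> \<le> max (SUP (s, t)\<in>{(s, t). 0 \<le> s \<and> s < t \<and> t \<le> 1}.
      ereal \<bar>ln ((\<theta> t - \<theta> s) / (t - s))\<bar>) (SUP r\<in>{0..1}. ereal \<bar>f (\<theta> r) - zero_path r\<bar>)"
    by (rule max.coboundedI2)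
qed

lemma zero_path_in_skorokhod_space: "zero_path \<in> skorokhod_space"
proof -
  have "continuous (at_right t) zero_path" if t: "t \<in> {0..<1}" for t
  proof -
    have "eventually (\<lambda>u. u \<in> {t<..<1}) (at_right t)"
      using t by (intro eventually_at_rightI) auto
    then have "eventually (\<lambda>u. zero_path u = 0) (at_right t)"
      by (rule eventually_mono) (use t in \<open>simp add: zero_path_def\<close>)
    moreover have "zero_path t = 0"
      using t by (simp add: zero_path_def)
    ultimately show ?thesis
      unfolding continuous_within by (simp add: tendsto_eventually)
  qed
  moreover have "\<exists>l. (zero_path \<longlongrightarrow> l) (at_left t)" if t: "t \<in> {0<..1}" for t
  proof -
    have "eventually (\<lambda>u. u \<in> {0<..<t}) (at_left t)"
      using t by (intro eventually_at_leftI) auto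
    then have "eventually (\<lambda>u. zero_path u = 0) (at_left t)"
      by (rule eventually_mono) (use t in \<open>simp add: zero_path_def\<close>)
    then show ?thesis
      by (intro exI tendsto_eventually)
  qed
  moreover have "zero_path \<in> extensional {0..1}"
    by (simp add: zero_path_def)
  ultimately show ?thesis
    unfolding skorokhod_space_def by blast
qed

lemma space_skorokhod_borel: "space skorokhod_borel = skorokhod_space"
  unfolding skorokhod_borel_def by (rule space_measure_of) (auto simp: skorokhod_open_def)

text \<open>
  A path other than the zero path is nonzero at some time \<open>u\<close>, which keeps it at distance at least
  its modulus there from the zero path. So the complement of the singleton is open.
\<close>

lemma singleton_zero_path_borel: "{zero_path} \<in> sets skorokhod_borel"
proof -
  have "skorokhod_open (skorokhod_space - {zero_path})"
    unfolding skorokhod_open_def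
  proof (intro conjI ballI)
    fix f assume f: "f \<in> skorokhod_space - {zero_path}"
    then obtain u where "f u \<noteq> zero_path u" "f \<in> extensional {0..1}"
      by (auto simp: skorokhod_space_def fun_eq_iff)
    then have "\<exists>u\<in>{0..1}. f u \<noteq> 0"
      by (intro bexI[of _ u]) (auto simp: zero_path_def extensional_def split: if_splits)
    then obtain u where u: "u \<in> {0..1}" "f u \<noteq> 0" by blast
    have "\<not> skorokhod_dist f zero_path < ereal \<bar>f u\<bar>"
      using skorokhod_dist_to_zero_path_ge[OF u(1), of f] by simp
    then show "\<exists>r>0. \<forall>h\<in>skorokhod_space. skorokhod_dist f h < ereal r
        \<longrightarrow> h \<in> skorokhod_space - {zero_path}"
      using u by (intro exI[of _ "\<bar>f u\<bar>"]) auto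
  qed auto
  then have "skorokhod_space - {zero_path} \<in> sets skorokhod_borel"
    unfolding skorokhod_borel_def
    by (subst sets_measure_of) (auto simp: skorokhod_open_def intro!: sigma_sets.Basic)
  then have "space skorokhod_borel - (skorokhod_space - {zero_path}) \<in> sets skorokhod_borel"
    by (rule sets.compl_sets)
  moreover have "space skorokhod_borel - (skorokhod_space - {zero_path}) = {zero_path}"
    using zero_path_in_skorokhod_space by (auto simp: space_skorokhod_borel)
  ultimately show ?thesis by simp
qed

text \<open>
  For a map that is not measurable, \<^const>\<open>distr\<close> is either still the image measure or the zero
  measure, which leaves one inequality.
\<close>

lemma measure_distr_le: "measure (distr M N f) A \<le> measure M (f -` A \<inter> space M)"
  by (simp add: distr_def measure_def emeasure_measure_of_conv)

text \<open>
  The singleton of the zero path has full mass under the limit law, while a path of modulus at least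
  \<open>r\<close> at time \<open>u\<close> is outside its \<open>\<delta>\<close>-neighbourhood for every \<open>\<delta> \<le> r\<close>.
\<close>

lemma prokhorov_dist_point_mass_ge:
  assumes M: "prob_space M" and N: "prob_space N" and u: "u \<in> {0..1}"
    and [measurable]: "{\<omega> \<in> space M. r \<le> \<bar>X \<omega> u\<bar>} \<in> sets M"
    and tail: "r \<le> measure M {\<omega> \<in> space M. r \<le> \<bar>X \<omega> u\<bar>}"
  shows "ereal r \<le> prokhorov_dist (distr M skorokhod_borel X)
           (distr N skorokhod_borel (\<lambda>_. zero_path))"
  unfolding prokhorov_dist_def
proof (rule INF_greatest, clarify)
  interpret M: prob_space M by (rule M)
  interpret N: prob_space N by (rule N)
  let ?\<mu> = "distr M skorokhod_borel X" and ?\<nu> = "distr N skorokhod_borel (\<lambda>_. zero_path)"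
  let ?B = "{\<omega> \<in> space M. r \<le> \<bar>X \<omega> u\<bar>}"
  fix \<delta> :: real
  assume "\<delta> > 0" and \<delta>: "\<forall>\<Gamma>\<in>sets skorokhod_borel.
      measure ?\<mu> \<Gamma> \<le> measure ?\<nu> (skorokhod_nbhd \<Gamma> \<delta>) + \<delta> \<and>
      measure ?\<nu> \<Gamma> \<le> measure ?\<mu> (skorokhod_nbhd \<Gamma> \<delta>) + \<delta>"
  show "ereal r \<le> ereal \<delta>"
  proof (rule ccontr)
    assume "\<not> ereal r \<le> ereal \<delta>"
    then have "\<delta> < r" by simp
    have "(\<lambda>_. zero_path) \<in> measurable N skorokhod_borel"
      using zero_path_in_skorokhod_space by (intro measurable_const) (simp add: space_skorokhod_borel)
    then have "measure ?\<nu> {zero_path} = 1"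
      by (simp add: measure_distr singleton_zero_path_borel N.prob_space)
    then have "1 \<le> measure ?\<mu> (skorokhod_nbhd {zero_path} \<delta>) + \<delta>"
      using bspec[OF \<delta> singleton_zero_path_borel] by (auto simp del: measure_distr)
    also have "measure ?\<mu> (skorokhod_nbhd {zero_path} \<delta>)
        \<le> measure M (X -` skorokhod_nbhd {zero_path} \<delta> \<inter> space M)"
      by (rule measure_distr_le)
    also have "\<dots> \<le> measure M (space M - ?B)"
    proof (rule M.finite_measure_mono)
      show "X -` skorokhod_nbhd {zero_path} \<delta> \<inter> space M \<subseteq> space M - ?B"
      proof clarify
        fix \<omega> assume \<omega>: "X \<omega> \<in> skorokhod_nbhd {zero_path} \<delta>" "r \<le> \<bar>X \<omega> u\<bar>"
        then have "skorokhod_dist zero_path (X \<omega>) < ereal \<delta>"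
          by (simp add: skorokhod_nbhd_def)
        then have "ereal \<bar>X \<omega> u\<bar> < ereal \<delta>"
          using skorokhod_dist_zero_path_ge[OF u, of "X \<omega>"] by (rule le_less_trans[rotated])
        then show False using \<omega>(2) \<open>\<delta> < r\<close> by simp
      qed
    qed measurable
    also have "\<dots> = 1 - measure M ?B"
      by (rule M.prob_compl) measurable
    finally show False using tail \<open>\<delta> < r\<close> by simp
  qed
qed

section \<open>Conditional expectations bounded by a constant\<close>

lemma (in sigma_finite_subalgebra) nn_cond_exp_le_const:
  assumes [measurable]: "g \<in> borel_measurable M" and "finite_measure M"
    and bound: "\<And>A. A \<in> sets F \<Longrightarrow> (\<integral>\<^sup>+x\<in>A. g x \<partial>M) \<le> ennreal c * emeasure M A"
  shows "AE x in M. nn_cond_exp M F g x \<le> ennreal c"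
proof -
  interpret finite_measure M by fact
  define h where "h = nn_cond_exp M F g"
  have hF [measurable]: "h \<in> borel_measurable F"
    unfolding h_def by simp
  have hM [measurable]: "h \<in> borel_measurable M"
    unfolding h_def by simp
  define A where "A = {x \<in> space M. ennreal c < h x}"
  have spF: "space F = space M"
    using subalg by (simp add: subalgebra_def)
  have "A = {x \<in> space F. ennreal c < h x}"
    by (simp add: A_def spF)
  also have "\<dots> \<in> sets F"
    by measurable
  finally have AF: "A \<in> sets F" .
  then have AM [measurable]: "A \<in> sets M"
    using subalg by (auto simp: subalgebra_def)
  \<comment> \<open>On the set where the bound fails, the excess has integral zero.\<close>
  have fin: "ennreal c * emeasure M A \<noteq> top"
    by (simp add: ennreal_mult_eq_top_iff)
  have "(\<integral>\<^sup>+x. (h x - ennreal c) * indicator A x \<partial>M) + ennreal c * emeasure M A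
      = (\<integral>\<^sup>+x. (h x - ennreal c) * indicator A x + ennreal c * indicator A x \<partial>M)"
    by (subst nn_integral_add) (auto simp: nn_integral_cmult_indicator)
  also have "\<dots> = (\<integral>\<^sup>+x. indicator A x * h x \<partial>M)"
    by (rule nn_integral_cong) (auto simp: A_def indicator_def less_imp_le diff_add_cancel_ennreal)
  also have "\<dots> = (\<integral>\<^sup>+x. indicator A x * g x \<partial>M)"
    unfolding h_def by (rule nn_cond_exp_intg) (use AF in auto)
  also have "\<dots> \<le> ennreal c * emeasure M A"
    using bound[OF AF] by (simp add: mult.commute)
  finally have "(\<integral>\<^sup>+x. (h x - ennreal c) * indicator A x \<partial>M) = 0"
    using fin by (cases "\<integral>\<^sup>+x. (h x - ennreal c) * indicator A x \<partial>M"; cases "ennreal c * emeasure M A")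
      (auto simp: ennreal_plus[symmetric] top_unique simp del: ennreal_plus)
  then have "AE x in M. (h x - ennreal c) * indicator A x = 0"
    by (subst (asm) nn_integral_0_iff_AE) auto
  then show ?thesis
    unfolding h_def[symmetric]
  proof (rule AE_mp, intro AE_I2 impI)
    fix x assume "x \<in> space M" "(h x - ennreal c) * indicator A x = 0"
    then show "h x \<le> ennreal c"
      by (cases "x \<in> A") (auto simp: A_def diff_eq_0_iff_ennreal)
  qed
qed

section \<open>Noise with at most one rare jump\<close>

text \<open>
  The index \<open>k\<close> encodes a jump of sign \<open>sgn k\<close> at time \<open>\<bar>k\<bar>\<close>, and \<open>k = 0\<close> encodes that there is no
  jump. Indexing by signed times makes the symmetry of the noise the symmetry of a law on the integers.
\<close>

definition jump_path :: "real \<Rightarrow> int \<Rightarrow> nat \<Rightarrow> real" where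
  "jump_path a k i = (if int i = \<bar>k\<bar> then of_int (sgn k) * a else 0)"

definition jump_index :: "nat \<Rightarrow> real \<Rightarrow> int pmf" where
  "jump_index H \<pi> =
     embed_pmf (\<lambda>k. if k = 0 then 1 - real H * \<pi> else if \<bar>k\<bar> \<le> int H then \<pi> / 2 else 0)"

definition jump_law :: "nat \<Rightarrow> real \<Rightarrow> real \<Rightarrow> (nat \<Rightarrow> real) pmf" where
  "jump_law H \<pi> a = map_pmf (jump_path a) (jump_index H \<pi>)"

text \<open>
  The sets of \<open>past t\<close> are exactly those determined by the coordinates up to \<open>t\<close>; all of them are
  events, as the noise has a discrete law.
\<close>

definition past :: "nat \<Rightarrow> (nat \<Rightarrow> real) measure" where
  "past t = vimage_algebra UNIV (\<lambda>\<omega> i. if i \<le> t then \<omega> i else 0) (count_space UNIV)"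

lemma space_past [simp]: "space (past t) = UNIV"
  by (simp add: past_def)

lemma sets_past: "sets (past t) = {A. \<forall>\<omega> \<omega>'. (\<forall>i\<le>t. \<omega> i = \<omega>' i) \<longrightarrow> (\<omega> \<in> A \<longleftrightarrow> \<omega>' \<in> A)}"
    (is "_ = ?R")
proof (rule set_eqI)
  fix A :: "(nat \<Rightarrow> real) set"
  define r :: "(nat \<Rightarrow> real) \<Rightarrow> nat \<Rightarrow> real" where "r = (\<lambda>\<omega> i. if i \<le> t then \<omega> i else 0)"
  have r: "r \<omega> = r \<omega>' \<longleftrightarrow> (\<forall>i\<le>t. \<omega> i = \<omega>' i)" for \<omega> \<omega>'
    unfolding r_def fun_eq_iff by (intro iff_allI) simp
  have "sets (past t) = {r -` B \<inter> UNIV | B. B \<in> sets (count_space UNIV)}"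
    unfolding past_def r_def by (rule sets_vimage_algebra2) simp
  then have "A \<in> sets (past t) \<longleftrightarrow> (\<exists>B. A = r -` B)"
    by simp
  also have "\<dots> \<longleftrightarrow> (\<forall>\<omega> \<omega>'. r \<omega> = r \<omega>' \<longrightarrow> (\<omega> \<in> A \<longleftrightarrow> \<omega>' \<in> A))"
  proof (intro iffI)
    assume R: "\<forall>\<omega> \<omega>'. r \<omega> = r \<omega>' \<longrightarrow> (\<omega> \<in> A \<longleftrightarrow> \<omega>' \<in> A)"
    have "r (r \<omega>) = r \<omega>" for \<omega>
      by (simp add: r_def fun_eq_iff)
    then have "r \<omega> \<in> A \<longleftrightarrow> \<omega> \<in> A" for \<omega>
      using R by metis
    then have "A = r -` A"
      by (simp add: set_eq_iff)
    then show "\<exists>B. A = r -` B" ..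
  qed auto
  also have "\<dots> \<longleftrightarrow> A \<in> ?R"
    by (simp add: r)
  finally show "A \<in> sets (past t) \<longleftrightarrow> A \<in> ?R" .
qed

lemma past_cong: "A \<in> sets (past t) \<Longrightarrow> (\<And>i. i \<le> t \<Longrightarrow> \<omega> i = \<omega>' i) \<Longrightarrow> \<omega> \<in> A \<longleftrightarrow> \<omega>' \<in> A"
  by (simp add: sets_past)

lemma filtration_past: "filtration UNIV past"
proof
  fix i j :: nat assume "i \<le> j"
  then have "\<forall>i'\<le>i. \<omega> i' = \<omega>' i'" if "\<forall>i'\<le>j. \<omega> i' = \<omega>' i'" for \<omega> \<omega>' :: "nat \<Rightarrow> real"
    using that by simp
  then show "sets (past i) \<subseteq> sets (past j)"
    unfolding sets_past by blast
qed simp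

lemma subalgebra_past: "subalgebra (measure_pmf P) (past t)"
  by (simp add: subalgebra_def)

lemma measurable_past_coordinate: "(\<lambda>\<omega>. \<omega> t) \<in> borel_measurable (past t)"
  by (rule measurableI) (auto simp: sets_past)

lemma jump_path_uminus: "jump_path a (- k) i = - jump_path a k i"
  by (simp add: jump_path_def)

lemma jump_path_before: "int i < \<bar>k\<bar> \<Longrightarrow> jump_path a k i = 0"
  by (simp add: jump_path_def)

lemma jump_path_zero [simp]: "jump_path a 0 i = 0"
  by (simp add: jump_path_def)

lemma jump_path_eq_0: "int i \<noteq> \<bar>k\<bar> \<Longrightarrow> jump_path a k i = 0"
  by (simp add: jump_path_def)

locale rare_jump =
  fixes H :: nat and \<pi> a :: real
  assumes prob_nonneg: "0 \<le> \<pi>" and half: "real H * \<pi> \<le> 1 / 2"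
begin

lemma pmf_jump_index:
  "pmf (jump_index H \<pi>) k = (if k = 0 then 1 - real H * \<pi> else if \<bar>k\<bar> \<le> int H then \<pi> / 2 else 0)"
  unfolding jump_index_def
proof (rule pmf_embed_pmf)
  let ?w = "\<lambda>k::int. if k = 0 then 1 - real H * \<pi> else if \<bar>k\<bar> \<le> int H then \<pi> / 2 else 0"
  show nonneg: "0 \<le> ?w k" for k
    using prob_nonneg half by auto
  have "(\<integral>\<^sup>+k. ennreal (?w k) \<partial>count_space UNIV) = (\<Sum>k\<in>{- int H..int H}. ennreal (?w k))"
    by (rule nn_integral_count_space') (auto split: if_splits)
  also have "\<dots> = ennreal (\<Sum>k\<in>{- int H..int H}. ?w k)"
    using nonneg by (intro sum_ennreal) auto
  also have "(\<Sum>k\<in>{- int H..int H}. ?w k) = ?w 0 + (\<Sum>k\<in>{- int H..int H} - {0}. ?w k)"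
    by (rule sum.remove) auto
  also have "(\<Sum>k\<in>{- int H..int H} - {0}. ?w k) = (\<Sum>k\<in>{- int H..int H} - {0}. \<pi> / 2)"
    by (rule sum.cong) auto
  also have "\<dots> = real H * \<pi>"
    by (simp add: card_Diff_singleton)
  finally show "(\<integral>\<^sup>+k. ennreal (?w k) \<partial>count_space UNIV) = 1"
    by simp
qed

lemma set_jump_index: "set_pmf (jump_index H \<pi>) \<subseteq> {- int H..int H}"
  by (auto simp: set_pmf_eq pmf_jump_index split: if_splits)

lemma finite_jump_index: "finite (set_pmf (jump_index H \<pi>))"
  by (rule finite_subset[OF set_jump_index]) simp

lemma integrable_jump_law:
  fixes f :: "(nat \<Rightarrow> real) \<Rightarrow> real"
  shows "integrable (measure_pmf (jump_law H \<pi> a)) f"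
  by (rule integrable_measure_pmf_finite) (simp add: jump_law_def finite_jump_index)

lemma map_uminus_jump_index: "map_pmf uminus (jump_index H \<pi>) = jump_index H \<pi>"
proof (rule pmf_eqI)
  fix k
  have "pmf (map_pmf uminus (jump_index H \<pi>)) (- (- k)) = pmf (jump_index H \<pi>) (- k)"
    by (rule pmf_map_inj') simp
  then show "pmf (map_pmf uminus (jump_index H \<pi>)) k = pmf (jump_index H \<pi>) k"
    by (simp add: pmf_jump_index)
qed

text \<open>
  Reflecting the index changes the sign of the noise at time \<open>t\<close> and, wherever that noise is nonzero,
  leaves the past before \<open>t\<close> unchanged.
\<close>

lemma cond_exp_noise:
  assumes "t \<ge> 1"
  shows "AE \<omega> in measure_pmf (jump_law H \<pi> a).
    real_cond_exp (measure_pmf (jump_law H \<pi> a)) (past (t - 1)) (\<lambda>\<omega>. \<omega> t) \<omega> = 0"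
proof -
  interpret finite_measure_subalgebra "measure_pmf (jump_law H \<pi> a)" "past (t - 1)"
    by standard (rule subalgebra_past)
  show ?thesis
  proof (rule real_cond_exp_charact)
    fix A assume A: "A \<in> sets (past (t - 1))"
    define f where "f k = indicat_real A (jump_path a k) * jump_path a k t" for k
    have odd: "f (- k) = - f k" for k
    proof (cases "int t = \<bar>k\<bar>")
      case True
      have "jump_path a (- k) \<in> A \<longleftrightarrow> jump_path a k \<in> A"
        using A by (rule past_cong) (use True assms in \<open>auto simp: jump_path_before\<close>)
      then show ?thesis
        by (simp add: f_def jump_path_uminus indicator_def)
    qed (simp add: f_def jump_path_eq_0)
    have "measure_pmf.expectation (jump_index H \<pi>) f
        = measure_pmf.expectation (map_pmf uminus (jump_index H \<pi>)) f"
      by (simp add: map_uminus_jump_index)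
    also have "\<dots> = - measure_pmf.expectation (jump_index H \<pi>) f"
      by (simp add: odd)
    finally have "measure_pmf.expectation (jump_index H \<pi>) f = 0"
      by simp
    then show "(\<integral>\<omega>\<in>A. \<omega> t \<partial>jump_law H \<pi> a) = (\<integral>\<omega>\<in>A. 0 \<partial>jump_law H \<pi> a)"
      by (simp add: jump_law_def set_lebesgue_integral_def f_def[abs_def])
  qed (auto intro: integrable_jump_law)
qed

lemma expectation_noise:
  assumes "t \<ge> 1" and even: "\<And>z. \<psi> (- z) = \<psi> z" and zero: "\<psi> 0 = (0::real)"
  shows "measure_pmf.expectation (jump_law H \<pi> a) (\<lambda>\<omega>. \<psi> (\<omega> t)) = (if t \<le> H then \<pi> * \<psi> a else 0)"
proof -
  let ?K = "if t \<le> H then {int t, - int t} else {}"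
  have "measure_pmf.expectation (jump_law H \<pi> a) (\<lambda>\<omega>. \<psi> (\<omega> t))
      = measure_pmf.expectation (jump_index H \<pi>) (\<lambda>k. \<psi> (jump_path a k t))"
    by (simp add: jump_law_def)
  also have "\<dots> = (\<Sum>k\<in>?K. \<psi> (jump_path a k t) * pmf (jump_index H \<pi>) k)"
  proof (rule integral_measure_pmf_real)
    fix k assume k: "k \<in> set_pmf (jump_index H \<pi>)" "\<psi> (jump_path a k t) \<noteq> 0"
    have "int t = \<bar>k\<bar>"
      using k(2) zero jump_path_eq_0 by metis
    then show "k \<in> ?K"
      using k(1) set_jump_index by (auto simp: abs_if split: if_splits)
  qed simp
  also have "\<dots> = (if t \<le> H then \<pi> * \<psi> a else 0)"
    using assms(1) even[of a] by (auto simp: pmf_jump_index jump_path_def)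
  finally show ?thesis .
qed

text \<open>
  A set in the past of \<open>t\<close> that contains the path without jumps has mass at least one half; any other
  such set contains no path that jumps at \<open>t\<close>. So conditioning increases the moments of the noise at
  most by a factor of two.
\<close>

lemma nn_cond_exp_noise_le:
  assumes t: "t \<ge> 1" and even: "\<And>z. \<psi> (- z) = \<psi> z" and zero: "\<psi> 0 = (0::real)"
    and nonneg: "\<And>z. 0 \<le> \<psi> z"
  shows "AE \<omega> in measure_pmf (jump_law H \<pi> a).
    nn_cond_exp (measure_pmf (jump_law H \<pi> a)) (past (t - 1)) (\<lambda>\<omega>. ennreal (\<psi> (\<omega> t))) \<omega>
      \<le> ennreal (if t \<le> H then 2 * \<pi> * \<psi> a else 0)"
proof -
  let ?P = "jump_law H \<pi> a"
  let ?c = "if t \<le> H then 2 * \<pi> * \<psi> a else 0"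
  interpret finite_measure_subalgebra "measure_pmf ?P" "past (t - 1)"
    by standard (rule subalgebra_past)
  show ?thesis
  proof (rule nn_cond_exp_le_const)
    fix A assume A: "A \<in> sets (past (t - 1))"
    show "(\<integral>\<^sup>+\<omega>\<in>A. ennreal (\<psi> (\<omega> t)) \<partial>?P) \<le> ennreal ?c * emeasure ?P A"
    proof (cases "jump_path a 0 \<in> A")
      case True
      have "(\<integral>\<^sup>+\<omega>\<in>A. ennreal (\<psi> (\<omega> t)) \<partial>?P) \<le> (\<integral>\<^sup>+\<omega>. ennreal (\<psi> (\<omega> t)) \<partial>?P)"
        by (rule nn_integral_mono) (auto simp: indicator_def)
      also have "\<dots> = ennreal (measure_pmf.expectation ?P (\<lambda>\<omega>. \<psi> (\<omega> t)))"
        by (rule nn_integral_eq_integral) (auto intro: integrable_jump_law simp: nonneg)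
      also have "\<dots> = ennreal (?c * (1 / 2))"
        using expectation_noise[of t \<psi>] t even zero by auto
      also have "\<dots> \<le> ennreal (?c * measure ?P A)"
      proof (intro ennreal_leI mult_left_mono)
        have "1 / 2 \<le> pmf (jump_index H \<pi>) 0"
          using half by (simp add: pmf_jump_index)
        also have "\<dots> \<le> measure (jump_index H \<pi>) (jump_path a -` A)"
          using True unfolding pmf.rep_eq by (intro measure_pmf.finite_measure_mono) auto
        finally show "1 / 2 \<le> measure ?P A"
          by (simp add: jump_law_def)
        show "0 \<le> ?c"
          using prob_nonneg nonneg by simp
      qed
      also have "\<dots> = ennreal ?c * emeasure ?P A"
        using prob_nonneg nonneg
        by (simp add: measure_pmf.emeasure_eq_measure ennreal_mult[symmetric])
      finally show ?thesis .
    next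
      case False
      have "ennreal (\<psi> (jump_path a k t)) * indicator A (jump_path a k) = 0" for k
      proof (cases "int t = \<bar>k\<bar>")
        case True
        have "jump_path a k \<in> A \<longleftrightarrow> jump_path a 0 \<in> A"
          using A by (rule past_cong) (use True t in \<open>auto simp: jump_path_before\<close>)
        then show ?thesis using False by simp
      qed (simp add: jump_path_eq_0 zero)
      then have "(\<integral>\<^sup>+\<omega>\<in>A. ennreal (\<psi> (\<omega> t)) \<partial>?P) = 0"
        by (simp add: jump_law_def del: mult_eq_0_iff)
      then show ?thesis by simp
    qed
  qed (auto intro: measure_pmf.finite_measure)
qed

end

section \<open>The oracle and its conditions\<close>

text \<open>
  The slope \<open>1 / \<eta>\<close> makes the contraction factor of the dynamics at time \<open>t\<close> equal to
  \<open>1 - t powr (- \<alpha>)\<close>, which is nonnegative from the first step on.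
\<close>

definition jump_oracle :: "real \<Rightarrow> nat \<Rightarrow> real \<Rightarrow> real \<Rightarrow> (nat \<Rightarrow> real) sgd_oracle" where
  "jump_oracle \<eta> H \<pi> a =
     \<lparr>mean_field = (\<lambda>x. x / \<eta>), noise = (\<lambda>t \<omega>. \<omega> t), filtr = past,
      prob_measure = measure_pmf (jump_law H \<pi> a)\<rparr>"

lemma jump_oracle_simps [simp]:
  "mean_field (jump_oracle \<eta> H \<pi> a) = (\<lambda>x. x / \<eta>)"
  "noise (jump_oracle \<eta> H \<pi> a) = (\<lambda>t \<omega>. \<omega> t)"
  "filtr (jump_oracle \<eta> H \<pi> a) = past"
  "prob_measure (jump_oracle \<eta> H \<pi> a) = measure_pmf (jump_law H \<pi> a)"
  by (simp_all add: jump_oracle_def)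

lemma iterate_jump_oracle_Suc:
  assumes "\<eta> > 0" "t \<ge> 1"
  shows "iterate (step_size \<eta> \<alpha>) (jump_oracle \<eta> H \<pi> a) (Suc t) \<omega>
    = (1 - real t powr (- \<alpha>)) * iterate (step_size \<eta> \<alpha>) (jump_oracle \<eta> H \<pi> a) t \<omega>
      + \<eta> * real t powr (- \<alpha>) * \<omega> t"
  using assms by (cases t) (auto simp: step_size_def field_simps)

lemma (in rare_jump) stochastic_oracle_jump_oracle: "stochastic_oracle (jump_oracle \<eta> H \<pi> a)"
  using filtration_past subalgebra_past measurable_past_coordinate integrable_jump_law
    cond_exp_noise measure_pmf.prob_space_axioms
  unfolding stochastic_oracle_def jump_oracle_simps by simp

lemma mean_field_cond_jump_oracle:
  "\<eta> > 0 \<Longrightarrow> mean_field_cond 1 0 0 (1 / \<eta>) (jump_oracle \<eta> H \<pi> a)"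
  by (simp add: mean_field_cond_def)

lemma (in rare_jump) noise_moment_cond_jump_oracle:
  assumes "a > 0" "\<pi> * a powr p \<le> 1" "p > 0"
  shows "noise_moment_cond p 2 (jump_oracle \<eta> H \<pi> a)"
proof -
  let ?P = "measure_pmf (jump_law H \<pi> a)"
  have "AE \<omega> in ?P. nn_cond_exp ?P (past (t - 1)) (\<lambda>\<omega>. ennreal (\<bar>\<omega> t\<bar> powr p)) \<omega> \<le> ennreal 2"
    if "t \<ge> 1" for t
  proof -
    have "ennreal (if t \<le> H then 2 * \<pi> * \<bar>a\<bar> powr p else 0) \<le> ennreal 2"
      using assms by (intro ennreal_leI) auto
    then show ?thesis
      using nn_cond_exp_noise_le[of t "\<lambda>z. \<bar>z\<bar> powr p"] that assms by (auto intro: order_trans)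
  qed
  then show ?thesis
    unfolding noise_moment_cond_def jump_oracle_simps AE_all_countable
    using cond_exp_noise by (auto intro: AE_conjI)
qed

text \<open>
  Up to time \<open>T\<close> the averaged conditional variances are at most \<open>2 * T powr (- 3 * \<gamma>)\<close>. Beyond \<open>T\<close>
  they decay like \<open>T / m\<close>, and \<open>T / m \<le> (T / m) powr (3 * \<gamma>)\<close> turns this into the rate in \<open>m\<close>.
\<close>

lemma (in rare_jump) noise_variance_cond_jump_oracle:
  assumes T: "T \<ge> 1" "H \<le> T" and variance: "\<pi> * a\<^sup>2 \<le> real T powr (- 3 * \<gamma>)"
    and \<gamma>: "0 \<le> \<gamma>" "3 * \<gamma> \<le> 1"
  shows "noise_variance_cond 2 \<gamma> 0 (jump_oracle \<eta> H \<pi> a)"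
proof -
  let ?P = "measure_pmf (jump_law H \<pi> a)"
  define v where "v t = real_cond_exp ?P (past (t - 1)) (\<lambda>\<omega>. (\<omega> t)\<^sup>2)" for t
  define b where "b t = (if t \<le> H then 2 * real T powr (- 3 * \<gamma>) else 0)" for t
  have v: "AE \<omega> in ?P. 0 \<le> v t \<omega> \<and> v t \<omega> \<le> b t" if "t \<ge> 1" for t
  proof -
    interpret finite_measure_subalgebra ?P "past (t - 1)"
      by standard (rule subalgebra_past)
    have "AE \<omega> in ?P. 0 \<le> v t \<omega>"
      unfolding v_def by (rule real_cond_exp_pos) auto
    moreover have "AE \<omega> in ?P. nn_cond_exp ?P (past (t - 1)) (\<lambda>\<omega>. ennreal ((\<omega> t)\<^sup>2)) \<omega>
        \<le> ennreal (if t \<le> H then 2 * \<pi> * a\<^sup>2 else 0)"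
      using nn_cond_exp_noise_le[of t "\<lambda>z. z\<^sup>2"] that by simp
    ultimately show ?thesis
    proof eventually_elim
      case (elim \<omega>)
      have "v t \<omega> \<le> enn2real (nn_cond_exp ?P (past (t - 1)) (\<lambda>\<omega>. ennreal ((\<omega> t)\<^sup>2)) \<omega>)"
        by (simp add: v_def real_cond_exp_def)
      also have "\<dots> \<le> (if t \<le> H then 2 * \<pi> * a\<^sup>2 else 0)"
        using elim(2) prob_nonneg by (intro enn2real_leI) auto
      also have "\<dots> \<le> b t"
        using variance by (simp add: b_def)
      finally show ?case using elim(1) by simp
    qed
  qed
  have "(\<integral>\<^sup>+\<omega>. ennreal (MAX n\<in>{0..m}. \<bar>(1 / real m) * (\<Sum>t = 1..n. v t \<omega>) - (real n / real m) * 0\<bar>) \<partial>?P)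
      \<le> ennreal (2 * real m powr (- 3 * \<gamma>))" if m: "m \<ge> 2" for m :: nat
  proof -
    define \<rho> where "\<rho> = real (min m T) / real m"
    have \<rho>: "0 < \<rho>" "\<rho> \<le> 1"
      using m T by (auto simp: \<rho>_def)
    have mT: "real (min m T) \<le> real T" by simp
    have "\<rho> * real T powr (- 3 * \<gamma>) \<le> \<rho> powr (3 * \<gamma>) * real T powr (- 3 * \<gamma>)"
      using powr_mono'[of "3 * \<gamma>" 1 \<rho>] \<rho> \<gamma> by (intro mult_right_mono) auto
    also have "\<dots> = (real (min m T) powr (3 * \<gamma>) * real T powr (- 3 * \<gamma>)) * real m powr (- 3 * \<gamma>)"
      using m T by (simp add: \<rho>_def powr_divide powr_minus field_simps)
    also have "real (min m T) powr (3 * \<gamma>) * real T powr (- 3 * \<gamma>) \<le> 1"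
      using powr_mono2[OF _ _ mT, of "3 * \<gamma>"] \<gamma> T by (simp add: powr_minus field_simps)
    finally have \<rho>_bound: "\<rho> * real T powr (- 3 * \<gamma>) \<le> real m powr (- 3 * \<gamma>)"
      by (simp add: mult_right_mono)
    have "AE \<omega> in ?P. \<forall>t\<ge>1. 0 \<le> v t \<omega> \<and> v t \<omega> \<le> b t"
      using v by (simp add: AE_all_countable)
    then have "AE \<omega> in ?P. (MAX n\<in>{0..m}. \<bar>(1 / real m) * (\<Sum>t = 1..n. v t \<omega>) - (real n / real m) * 0\<bar>)
        \<le> 2 * real m powr (- 3 * \<gamma>)"
    proof eventually_elim
      case (elim \<omega>)
      have "\<bar>(1 / real m) * (\<Sum>t = 1..n. v t \<omega>) - (real n / real m) * 0\<bar> \<le> 2 * real m powr (- 3 * \<gamma>)"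
        if n: "n \<le> m" for n
      proof -
        have "(\<Sum>t = 1..n. v t \<omega>) \<le> (\<Sum>t = 1..n. b t)"
          using elim by (intro sum_mono) auto
        also have "\<dots> = (\<Sum>t \<in> {1..min n H}. 2 * real T powr (- 3 * \<gamma>))"
          by (rule sum.mono_neutral_cong_right) (auto simp: b_def)
        also have "\<dots> \<le> real (min m T) * (2 * real T powr (- 3 * \<gamma>))"
          using n T by (auto intro!: mult_right_mono)
        finally have "(1 / real m) * (\<Sum>t = 1..n. v t \<omega>)
            \<le> (1 / real m) * (real (min m T) * (2 * real T powr (- 3 * \<gamma>)))"
          by (rule mult_left_mono) simp
        also have "\<dots> = 2 * (\<rho> * real T powr (- 3 * \<gamma>))"
          by (simp add: \<rho>_def)
        also have "\<dots> \<le> 2 * real m powr (- 3 * \<gamma>)"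
          using \<rho>_bound by simp
        finally have "(1 / real m) * (\<Sum>t = 1..n. v t \<omega>) \<le> 2 * real m powr (- 3 * \<gamma>)" .
        moreover have "0 \<le> (1 / real m) * (\<Sum>t = 1..n. v t \<omega>)"
          using elim by (intro mult_nonneg_nonneg sum_nonneg) auto
        ultimately show ?thesis by simp
      qed
      then show ?case
        by (subst Max_le_iff) auto
    qed
    then have "(\<integral>\<^sup>+\<omega>. ennreal (MAX n\<in>{0..m}. \<bar>(1 / real m) * (\<Sum>t = 1..n. v t \<omega>) - (real n / real m) * 0\<bar>) \<partial>?P)
        \<le> (\<integral>\<^sup>+\<omega>. ennreal (2 * real m powr (- 3 * \<gamma>)) \<partial>?P)"
      by (intro nn_integral_mono_AE) (auto intro: ennreal_leI elim: eventually_mono)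
    then show ?thesis by simp
  qed
  then show ?thesis
    unfolding noise_variance_cond_def jump_oracle_simps v_def
    using integrable_jump_law by blast
qed

section \<open>Moments of the iterates\<close>

text \<open>
  While \<open>u = t powr (- \<alpha>)\<close> is large compared with \<open>1 / t\<close>, the contraction \<open>1 - u\<close> outpaces the decay
  of \<open>u powr q\<close> from \<open>t\<close> to \<open>Suc t\<close>, with enough room left to absorb the forcing term because
  \<open>2 * q \<ge> q + 1\<close>. This happens for all large \<open>t\<close>, as \<open>\<alpha> < 1\<close>; before that the linear growth
  \<open>m t \<le> B * t\<close> suffices.
\<close>

lemma contraction_recursion_bound:
  fixes \<alpha> q B :: real
  assumes \<alpha>: "0 < \<alpha>" "\<alpha> < 1" and q: "1 \<le> q" and B: "0 \<le> B"
  obtains C where "0 \<le> C"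
    and "\<And>m t. m 1 = 0 \<Longrightarrow> (\<And>t. t \<ge> 1 \<Longrightarrow> 0 \<le> m t) \<Longrightarrow>
      (\<And>t. t \<ge> 1 \<Longrightarrow>
        m (Suc t) \<le> (1 - real t powr (- \<alpha>)) * m t + B * (real t powr (- \<alpha>)) powr (2 * q)) \<Longrightarrow>
      t \<ge> 1 \<Longrightarrow> m t \<le> C * (real t powr (- \<alpha>)) powr q"
proof -
  have "filterlim (\<lambda>t. real t powr (1 - \<alpha>)) at_top sequentially"
    using \<alpha> by real_asymp
  then have "eventually (\<lambda>t. 2 * (\<alpha> * q) \<le> real t powr (1 - \<alpha>)) sequentially"
    by (simp add: filterlim_at_top)
  then obtain t0 where t0: "\<And>t. t \<ge> t0 \<Longrightarrow> 2 * (\<alpha> * q) \<le> real t powr (1 - \<alpha>)"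
    by (auto simp: eventually_sequentially)
  define t1 where "t1 = max 1 t0"
  define C where "C = max (2 * B) (B * real t1 / (real t1 powr (- \<alpha>)) powr q)"
  have C: "2 * B \<le> C" "B * real t1 \<le> C * (real t1 powr (- \<alpha>)) powr q"
    by (auto simp: C_def t1_def max_def field_simps)
  have C0: "0 \<le> C" using C B by simp
  have "m t \<le> C * (real t powr (- \<alpha>)) powr q"
    if m1: "m 1 = 0" and m0: "\<And>t. t \<ge> 1 \<Longrightarrow> 0 \<le> m t" and t: "t \<ge> 1"
      and rec: "\<And>t. t \<ge> 1 \<Longrightarrow>
        m (Suc t) \<le> (1 - real t powr (- \<alpha>)) * m t + B * (real t powr (- \<alpha>)) powr (2 * q)"
    for m :: "nat \<Rightarrow> real" and t
  proof -
    have u01: "0 < real t powr (- \<alpha>) \<and> real t powr (- \<alpha>) \<le> 1" if "t \<ge> 1" for t :: nat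
      using that \<alpha> by (auto simp: powr_minus field_simps ge_one_powr_ge_zero)
    have early: "m t \<le> B * real t" if "t \<ge> 1" for t
      using that
    proof (induction t rule: nat_induct_at_least)
      case base
      then show ?case using m1 B by simp
    next
      case (Suc t)
      have u: "0 < real t powr (- \<alpha>)" "real t powr (- \<alpha>) \<le> 1"
        using u01[of t] Suc by auto
      have "m (Suc t) \<le> (1 - real t powr (- \<alpha>)) * m t + B * (real t powr (- \<alpha>)) powr (2 * q)"
        using rec Suc by simp
      also have "\<dots> \<le> 1 * m t + B * 1"
        using u m0[of t] Suc B q
        by (intro add_mono mult_right_mono mult_left_mono) (auto intro: powr_le1)
      finally show ?case using Suc by (simp add: algebra_simps)
    qed
    show ?thesis
    proof (cases "t \<le> t1")
      case True
      have "m t \<le> B * real t" by (rule early[OF t])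
      also have "\<dots> \<le> B * real t1" using True B by (simp add: mult_left_mono)
      also have "\<dots> \<le> C * (real t1 powr (- \<alpha>)) powr q" by (rule C(2))
      also have "\<dots> \<le> C * (real t powr (- \<alpha>)) powr q"
        using C0 True t \<alpha> q by (intro mult_left_mono powr_mono2 powr_mono2') auto
      finally show ?thesis .
    next
      case False
      then have "t1 \<le> t" by simp
      then show ?thesis
      proof (induction t rule: dec_induct)
        case base
        show ?case using early[of t1] C(2) by (simp add: t1_def)
      next
        case (step t)
        define u where "u = real t powr (- \<alpha>)"
        have t: "t \<ge> 1" "t \<ge> t0" using step by (auto simp: t1_def)
        have u: "0 < u" "u \<le> 1" using u01[of t] t by (auto simp: u_def)
        have "m (Suc t) \<le> (1 - u) * m t + B * u powr (2 * q)"
          using rec t by (simp add: u_def)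
        also have "\<dots> \<le> (1 - u) * (C * u powr q) + C / 2 * (u * u powr q)"
        proof (intro add_mono mult_left_mono)
          show "m t \<le> C * u powr q" using step by (simp add: u_def)
          have "u powr (2 * q) \<le> u powr (1 + q)"
            using u q by (intro powr_mono') auto
          then show "B * u powr (2 * q) \<le> C / 2 * (u * u powr q)"
            using C B u by (intro mult_mono) (auto simp: powr_add)
        qed (use u in auto)
        also have "\<dots> = C * u powr q * (1 - u / 2)"
          by (simp add: algebra_simps)
        also have "\<dots> \<le> C * u powr q * (real (Suc t) / real t) powr (- (\<alpha> * q))"
        proof (intro mult_left_mono)
          \<comment> \<open>Bernoulli's inequality \<open>(1 + 1 / t) powr (- s) \<ge> 1 - s / t\<close> with \<open>s = \<alpha> * q\<close>.\<close>
          have "\<alpha> * q / real t \<le> u / 2"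
            using t0[OF t(2)] t by (simp add: u_def powr_diff powr_minus field_simps)
          moreover
          have "ln (real (Suc t) / real t) \<le> 1 / real t"
            using ln_add_one_self_le_self[of "1 / real t"] t by (simp add: field_simps)
          then have "\<alpha> * q * ln (real (Suc t) / real t) \<le> \<alpha> * q * (1 / real t)"
            using \<alpha> q by (intro mult_left_mono) auto
          then have "\<alpha> * q * ln (real (Suc t) / real t) \<le> \<alpha> * q / real t"
            by simp
          moreover have "1 - \<alpha> * q * ln (real (Suc t) / real t)
              \<le> exp (- (\<alpha> * q) * ln (real (Suc t) / real t))"
            using exp_ge_add_one_self[of "- (\<alpha> * q) * ln (real (Suc t) / real t)"] by simp
          ultimately have "1 - u / 2 \<le> exp (- (\<alpha> * q) * ln (real (Suc t) / real t))"
            by linarith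
          then show "1 - u / 2 \<le> (real (Suc t) / real t) powr (- (\<alpha> * q))"
            using t by (simp add: powr_def)
        qed (use C0 in auto)
        also have "\<dots> = C * (real (Suc t) powr (- \<alpha>)) powr q"
          using t by (simp add: u_def powr_powr powr_divide powr_minus field_simps)
        finally show ?case .
      qed
    qed
  qed
  with C0 show ?thesis using that by blast
qed

lemma iterate_eq_0_before_jump:
  assumes "\<eta> > 0" "int t \<le> \<bar>k\<bar>"
  shows "iterate (step_size \<eta> \<alpha>) (jump_oracle \<eta> H \<pi> a) t (jump_path a k) = 0"
  using assms(2)
proof (induction t)
  case (Suc t)
  then show ?case
    by (cases "t \<ge> 1") (auto simp: iterate_jump_oracle_Suc[OF assms(1)] jump_path_before not_less_eq_eq)
qed simp

text \<open>
  There is at most one jump, so at each time the iterate or the noise vanishes and the absolute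
  moments add up exactly.
\<close>

lemma (in rare_jump) iterate_moment_recursion:
  fixes \<eta> \<alpha> r :: real
  assumes "\<eta> > 0" "\<alpha> > 0" "r > 0" "t \<ge> 1"
  defines "m \<equiv> \<lambda>t. measure_pmf.expectation (jump_law H \<pi> a)
      (\<lambda>\<omega>. \<bar>iterate (step_size \<eta> \<alpha>) (jump_oracle \<eta> H \<pi> a) t \<omega>\<bar> powr r)"
  shows "m (Suc t) = (1 - real t powr (- \<alpha>)) powr r * m t
      + (\<eta> * real t powr (- \<alpha>)) powr r * (if t \<le> H then \<pi> * \<bar>a\<bar> powr r else 0)"
proof -
  let ?x = "iterate (step_size \<eta> \<alpha>) (jump_oracle \<eta> H \<pi> a)"
  define u where "u = real t powr (- \<alpha>)"
  have u: "0 \<le> u" "u \<le> 1"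
    using assms by (auto simp: u_def powr_minus field_simps ge_one_powr_ge_zero)
  have "\<bar>?x (Suc t) \<omega>\<bar> powr r = (1 - u) powr r * \<bar>?x t \<omega>\<bar> powr r + (\<eta> * u) powr r * \<bar>\<omega> t\<bar> powr r"
    if \<omega>: "\<omega> \<in> set_pmf (jump_law H \<pi> a)" for \<omega>
  proof -
    obtain k where k: "\<omega> = jump_path a k"
      using \<omega> by (auto simp: jump_law_def)
    show ?thesis
    proof (cases "int t = \<bar>k\<bar>")
      case True
      then have "?x t \<omega> = 0"
        unfolding k using assms(1) by (intro iterate_eq_0_before_jump) auto
      then show ?thesis
        using assms(1,3,4) u
        by (simp add: iterate_jump_oracle_Suc u_def[symmetric] abs_mult powr_mult)
    next
      case False
      then have "\<omega> t = 0"
        unfolding k by (rule jump_path_eq_0)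
      then show ?thesis
        using assms(1,3,4) u
        by (simp add: iterate_jump_oracle_Suc u_def[symmetric] abs_mult powr_mult)
    qed
  qed
  then have "m (Suc t) = measure_pmf.expectation (jump_law H \<pi> a)
      (\<lambda>\<omega>. (1 - u) powr r * \<bar>?x t \<omega>\<bar> powr r + (\<eta> * u) powr r * \<bar>\<omega> t\<bar> powr r)"
    unfolding m_def by (intro integral_cong_AE) (auto simp: AE_measure_pmf_iff)
  also have "\<dots> = (1 - u) powr r * m t + (\<eta> * u) powr r
      * measure_pmf.expectation (jump_law H \<pi> a) (\<lambda>\<omega>. \<bar>\<omega> t\<bar> powr r)"
    unfolding m_def by (subst Bochner_Integration.integral_add) (auto intro: integrable_jump_law)
  also have "measure_pmf.expectation (jump_law H \<pi> a) (\<lambda>\<omega>. \<bar>\<omega> t\<bar> powr r)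
      = (if t \<le> H then \<pi> * \<bar>a\<bar> powr r else 0)"
    using assms by (intro expectation_noise) auto
  finally show ?thesis by (simp add: u_def)
qed

lemma iterate_moment_cond_jump_oracle:
  fixes \<eta> \<alpha> q :: real
  assumes \<eta>: "\<eta> > 0" and \<alpha>: "0 < \<alpha>" "\<alpha> < 1" and q: "1 \<le> q"
  obtains C where "\<And>H \<pi> a. rare_jump H \<pi> \<Longrightarrow> \<pi> * \<bar>a\<bar> powr (2 * q) \<le> 1 \<Longrightarrow>
    iterate_moment_cond (step_size \<eta> \<alpha>) q C (jump_oracle \<eta> H \<pi> a)"
proof -
  obtain C where C: "0 \<le> C"
    and bound: "\<And>m t. m 1 = 0 \<Longrightarrow> (\<And>t. t \<ge> 1 \<Longrightarrow> 0 \<le> m t) \<Longrightarrow>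
      (\<And>t. t \<ge> 1 \<Longrightarrow> m (Suc t)
        \<le> (1 - real t powr (- \<alpha>)) * m t + \<eta> powr (2 * q) * (real t powr (- \<alpha>)) powr (2 * q)) \<Longrightarrow>
      t \<ge> 1 \<Longrightarrow> m t \<le> C * (real t powr (- \<alpha>)) powr q"
    using contraction_recursion_bound[OF \<alpha> q, of "\<eta> powr (2 * q)"] by (metis powr_ge_zero)
  have "iterate_moment_cond (step_size \<eta> \<alpha>) q (C / \<eta> powr q) (jump_oracle \<eta> H \<pi> a)"
    if jump: "rare_jump H \<pi>" and a: "\<pi> * \<bar>a\<bar> powr (2 * q) \<le> 1" for H \<pi> a
    unfolding iterate_moment_cond_def
  proof (intro allI impI)
    interpret rare_jump H \<pi> a by (rule jump)
    fix t :: nat assume t: "t \<ge> 1"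
    let ?x = "iterate (step_size \<eta> \<alpha>) (jump_oracle \<eta> H \<pi> a)"
    define m where "m t = measure_pmf.expectation (jump_law H \<pi> a) (\<lambda>\<omega>. \<bar>?x t \<omega>\<bar> powr (2 * q))" for t
    have m0: "0 \<le> m t" for t
      by (simp add: m_def)
    have "m t \<le> C * (real t powr (- \<alpha>)) powr q"
    proof (rule bound)
      show "m 1 = 0" by (simp add: m_def)
      fix t :: nat assume t: "t \<ge> 1"
      define u where "u = real t powr (- \<alpha>)"
      have u: "0 \<le> u" "u \<le> 1"
        using t \<alpha> by (auto simp: u_def powr_minus field_simps ge_one_powr_ge_zero)
      have "m (Suc t) = (1 - u) powr (2 * q) * m t
          + (\<eta> * u) powr (2 * q) * (if t \<le> H then \<pi> * \<bar>a\<bar> powr (2 * q) else 0)"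
        unfolding m_def u_def by (rule iterate_moment_recursion) (use assms t in auto)
      also have "\<dots> \<le> (1 - u) * m t + (\<eta> * u) powr (2 * q) * 1"
        using u q a m0 prob_nonneg powr_mono'[of 1 "2 * q" "1 - u"] by (intro add_mono mult_mono) auto
      finally show "m (Suc t)
          \<le> (1 - real t powr (- \<alpha>)) * m t + \<eta> powr (2 * q) * (real t powr (- \<alpha>)) powr (2 * q)"
        using u \<eta> by (simp add: u_def powr_mult)
    qed (use m0 t in auto)
    also have "\<dots> = C / \<eta> powr q * step_size \<eta> \<alpha> t powr q"
      using \<eta> by (simp add: step_size_def powr_mult)
    finally have "ennreal (m t) \<le> ennreal (C / \<eta> powr q * step_size \<eta> \<alpha> t powr q)"
      by (rule ennreal_leI)
    moreover have "(\<integral>\<^sup>+\<omega>. ennreal (\<bar>?x t \<omega>\<bar> powr (2 * q)) \<partial>jump_law H \<pi> a) = ennreal (m t)"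
      unfolding m_def by (rule nn_integral_eq_integral) (auto intro: integrable_jump_law)
    ultimately show "(\<integral>\<^sup>+\<omega>. ennreal (\<bar>?x t \<omega>\<bar> powr (2 * q)) \<partial>prob_measure (jump_oracle \<eta> H \<pi> a))
        \<le> ennreal (C / \<eta> powr q * step_size \<eta> \<alpha> t powr q)"
      by simp
  qed
  then show ?thesis using that by blast
qed

section \<open>The response of the averaged path to a jump\<close>

text \<open>
  The iterate at time \<open>t\<close> of the recursion with contraction factors \<open>1 - t powr (- \<alpha>)\<close>, when its only
  forcing is the amount \<open>j powr (- \<alpha>)\<close> at time \<open>j\<close>.
\<close>

definition response :: "real \<Rightarrow> nat \<Rightarrow> nat \<Rightarrow> real" where
  "response \<alpha> j t = (if t \<le> j then 0
     else real j powr (- \<alpha>) * (\<Prod>i\<in>{Suc j..<t}. 1 - real i powr (- \<alpha>)))"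

lemma response_Suc:
  "j < t \<Longrightarrow> response \<alpha> j (Suc t) = (1 - real t powr (- \<alpha>)) * response \<alpha> j t"
  by (simp add: response_def)

lemma response_nonneg: "\<alpha> > 0 \<Longrightarrow> 0 \<le> response \<alpha> j t"
proof -
  assume "\<alpha> > 0"
  then have "0 \<le> 1 - real i powr (- \<alpha>)" if "Suc j \<le> i" for i
    using that by (simp add: powr_minus field_simps ge_one_powr_ge_zero)
  then show ?thesis
    unfolding response_def by (auto intro!: mult_nonneg_nonneg prod_nonneg)
qed

lemma iterate_eq_response:
  assumes "\<eta> > 0" "k \<noteq> 0"
  shows "iterate (step_size \<eta> \<alpha>) (jump_oracle \<eta> H \<pi> a) t (jump_path a k)
    = \<eta> * of_int (sgn k) * a * response \<alpha> (nat \<bar>k\<bar>) t"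
proof (induction t)
  case 0
  then show ?case by (simp add: response_def)
next
  case (Suc t)
  consider "t < nat \<bar>k\<bar>" | "t = nat \<bar>k\<bar>" | "nat \<bar>k\<bar> < t" by linarith
  then show ?case
  proof cases
    case 1
    then show ?thesis
      using iterate_eq_0_before_jump[of \<eta> "Suc t" k] assms by (simp add: response_def)
  next
    case 2
    then show ?thesis
      using Suc assms
      by (simp add: iterate_jump_oracle_Suc response_def jump_path_def)
  next
    case 3
    then have "jump_path a k t = 0"
      by (intro jump_path_eq_0) auto
    with 3 show ?thesis
      using Suc assms by (simp add: iterate_jump_oracle_Suc response_Suc)
  qed
qed

text \<open>
  Each step removes the amount \<open>t powr (- \<alpha>) * response \<alpha> j t \<le> j powr (- \<alpha>) * response \<alpha> j t\<close>, so the
  total is at least the decrease of the response, rescaled by \<open>j powr \<alpha>\<close>.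
\<close>

lemma sum_response_ge:
  assumes "\<alpha> > 0" "j \<ge> 1" "j \<le> n"
  shows "real j powr \<alpha> * (response \<alpha> j (Suc j) - response \<alpha> j (Suc n))
    \<le> (\<Sum>t\<in>{Suc j..n}. response \<alpha> j t)"
  using assms(3)
proof (induction n rule: dec_induct)
  case (step n)
  have "real j powr \<alpha> * (response \<alpha> j (Suc n) - response \<alpha> j (Suc (Suc n)))
      = (real j powr \<alpha> * real (Suc n) powr (- \<alpha>)) * response \<alpha> j (Suc n)"
    using step by (simp add: response_Suc algebra_simps)
  also have "\<dots> \<le> 1 * response \<alpha> j (Suc n)"
  proof (intro mult_right_mono response_nonneg assms)
    have "real j powr \<alpha> \<le> real (Suc n) powr \<alpha>"
      using step assms by (intro powr_mono2) auto
    then show "real j powr \<alpha> * real (Suc n) powr (- \<alpha>) \<le> 1"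
      by (simp add: powr_minus field_simps)
  qed
  finally show ?case
    using step by (simp add: algebra_simps)
qed simp

text \<open>
  A jump in the first half of the horizon \<open>T\<close> is followed by at least \<open>T / 2\<close> contractions by a factor
  at most \<open>1 - T powr (- \<alpha>)\<close>. They leave at most half of the response once \<open>T powr (1 - \<alpha>) \<ge> 2\<close>.
\<close>

lemma sum_response_ge_half:
  assumes \<alpha>: "0 < \<alpha>" "\<alpha> < 1" and j: "1 \<le> j" "2 * j \<le> T" and T: "2 \<le> real T powr (1 - \<alpha>)"
  shows "1 / 2 \<le> (\<Sum>t\<in>{Suc j..T}. response \<alpha> j t)"
proof -
  let ?p = "\<Prod>i\<in>{Suc j..<Suc T}. 1 - real i powr (- \<alpha>)"
  have Tpos: "0 < real T" using j by simp
  have "?p \<le> (\<Prod>i\<in>{Suc j..<Suc T}. exp (- (real T powr (- \<alpha>))))"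
  proof (intro prod_mono conjI)
    fix i assume i: "i \<in> {Suc j..<Suc T}"
    show "0 \<le> 1 - real i powr (- \<alpha>)"
      using i \<alpha> by (auto simp: powr_minus field_simps ge_one_powr_ge_zero)
    have "real T powr (- \<alpha>) \<le> real i powr (- \<alpha>)"
      using i \<alpha> by (intro powr_mono2') auto
    then show "1 - real i powr (- \<alpha>) \<le> exp (- (real T powr (- \<alpha>)))"
      using exp_ge_add_one_self[of "- (real T powr (- \<alpha>))"] by linarith
  qed
  also have "\<dots> = exp (- (real (T - j) * real T powr (- \<alpha>)))"
    by (simp add: exp_of_nat_mult[symmetric])
  also have "\<dots> \<le> exp (- 1)"
  proof -
    have "2 \<le> real T * real T powr (- \<alpha>)"
      using T Tpos by (simp add: powr_diff powr_minus divide_inverse)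
    also have "\<dots> \<le> (2 * real (T - j)) * real T powr (- \<alpha>)"
      using j by (intro mult_right_mono) auto
    finally show ?thesis by (simp del: of_nat_diff)
  qed
  also have "\<dots> \<le> 1 / 2"
    using exp_ge_add_one_self[of 1] by (simp add: exp_minus field_simps)
  finally have "?p \<le> 1 / 2" .
  moreover have "real j powr \<alpha> * (response \<alpha> j (Suc j) - response \<alpha> j (Suc T)) = 1 - ?p"
    using j by (simp add: response_def powr_minus field_simps del: prod.op_ivl_Suc)
  ultimately show ?thesis
    using sum_response_ge[of \<alpha> j T] \<alpha> j by simp
qed

lemma sgd_path_at_1: "sgd_path h T M \<omega> 1 = partial_sum h M \<omega> T / sqrt (real T)"
  by (simp add: sgd_path_def Let_def)

lemma jump_moves_path:
  assumes \<eta>: "\<eta> > 0" and \<alpha>: "0 < \<alpha>" "\<alpha> < 1" and k: "k \<noteq> 0" "2 * \<bar>k\<bar> \<le> int T"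
    and T: "2 \<le> real T powr (1 - \<alpha>)" and a: "a \<ge> 0"
  shows "\<eta> / 2 * (a / sqrt (real T))
    \<le> \<bar>sgd_path (step_size \<eta> \<alpha>) T (jump_oracle \<eta> H \<pi> a) (jump_path a k) 1\<bar>"
proof -
  let ?j = "nat \<bar>k\<bar>"
  have "1 / 2 \<le> (\<Sum>t\<in>{Suc ?j..T}. response \<alpha> ?j t)"
    using \<alpha> k T by (intro sum_response_ge_half) auto
  also have "\<dots> \<le> (\<Sum>t\<in>{2..Suc T}. response \<alpha> ?j t)"
    using k by (intro sum_mono2 response_nonneg \<alpha>) auto
  also have "\<dots> = (\<Sum>t = 1..T. response \<alpha> ?j (t + 1))"
    unfolding numeral_2_eq_2 by (simp add: sum.atLeast_Suc_atMost_Suc_shift del: sum.cl_ivl_Suc)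
  finally have "\<eta> * a * (1 / 2) \<le> \<eta> * a * (\<Sum>t = 1..T. response \<alpha> ?j (t + 1))"
    using \<eta> a by (intro mult_left_mono) auto
  also have "\<dots> = \<bar>partial_sum (step_size \<eta> \<alpha>) (jump_oracle \<eta> H \<pi> a) (jump_path a k) T\<bar>"
  proof -
    have "partial_sum (step_size \<eta> \<alpha>) (jump_oracle \<eta> H \<pi> a) (jump_path a k) T
        = \<eta> * of_int (sgn k) * a * (\<Sum>t = 1..T. response \<alpha> ?j (t + 1))"
      unfolding partial_sum_def sum_distrib_left
      by (intro sum.cong refl iterate_eq_response \<eta> k)
    moreover have "\<bar>of_int (sgn k) :: real\<bar> = 1"
      using k by (simp add: sgn_if)
    moreover have "0 \<le> (\<Sum>t = 1..T. response \<alpha> ?j (t + 1))"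
      by (intro sum_nonneg response_nonneg \<alpha>)
    ultimately show ?thesis
      using \<eta> a by (simp add: abs_mult)
  qed
  finally have "\<eta> * a * (1 / 2) / sqrt (real T)
      \<le> \<bar>partial_sum (step_size \<eta> \<alpha>) (jump_oracle \<eta> H \<pi> a) (jump_path a k) T\<bar> / sqrt (real T)"
    by (rule divide_right_mono) simp
  then show ?thesis
    by (simp add: sgd_path_at_1 abs_divide)
qed

section \<open>The lower bound\<close>

theorem theorem3p4:
  fixes \<eta> \<alpha> p q :: real
    and N :: "'b measure" and W :: "real \<Rightarrow> 'b \<Rightarrow> real"
  assumes "standard_brownian_motion N W"
    and "\<eta> > 0" and "1 / 2 < \<alpha>" and "\<alpha> < 1"
    and "p > 2" and "1 \<le> q" and "q \<le> p / 2"
    and "(p - 2) / (2 * (p + 1)) < (1 - \<alpha>) / 2"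
  shows "\<exists>(\<CC> :: (nat \<Rightarrow> real) sgd_oracle set) (G :: (nat \<Rightarrow> real) sgd_oracle \<Rightarrow> real)
            (S :: (nat \<Rightarrow> real) sgd_oracle \<Rightarrow> real).
           \<CC> \<noteq> {} \<and>
           (\<forall>M\<in>\<CC>. stochastic_oracle M) \<and>
           uniform_conditions (step_size \<eta> \<alpha>) p q G S \<CC> \<and>
           (\<exists>c>0. \<exists>T0::nat. \<forall>T\<ge>T0.
              worst_case_error N W (step_size \<eta> \<alpha>) G S T \<CC>
                \<ge> ereal (c * real T powr (- ((p - 2) / (2 * (p + 1))))))"
proof -
  define \<beta> where "\<beta> = (p - 2) / (2 * (p + 1))"
  have "\<beta> < (1 - \<alpha>) / 2"
    using assms(8) by (simp only: \<beta>_def)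
  also have "(1 - \<alpha>) / 2 < 1 / 4"
    using assms(3) by simp
  finally have "\<beta> < 1 / 4" .
  moreover have "0 < \<beta>"
    using assms(5) by (simp add: \<beta>_def)
  ultimately have \<beta>: "0 < \<beta>" "3 * \<beta> \<le> 1" "\<beta> \<le> 1 / 2"
    by auto
  \<comment> \<open>The exponent for which \<open>\<pi> T * a T powr p = 1\<close> below.\<close>
  have \<beta>p: "(1 / 2 - \<beta>) * p = 1 + \<beta>"
    using assms by (simp add: \<beta>_def field_simps)
  \<comment> \<open>A jump of size \<open>T powr (1 / 2 - \<beta>)\<close> moves the normalised path by the order of \<open>T powr (- \<beta>)\<close>;
    the bound on the \<open>p\<close>-th moment then allows a jump probability of the same order, spread over
    \<open>T\<close> times.\<close>
  define \<pi> a where "\<pi> T = real T powr (- \<beta> - 1)" and "a T = real T powr (1 / 2 - \<beta>)" for T :: nat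
  define M where "M T = jump_oracle \<eta> (T div 2) (\<pi> T) (a T)" for T
  have rare: "rare_jump (T div 2) (\<pi> T)" if "T \<ge> 1" for T
  proof
    have "real (T div 2) * \<pi> T \<le> real T / 2 * \<pi> T"
      by (intro mult_right_mono) (auto simp: \<pi>_def)
    also have "\<dots> = real T powr (- \<beta>) / 2"
      using that by (simp add: \<pi>_def powr_diff)
    also have "\<dots> \<le> 1 / 2"
      using that \<beta> by (simp add: powr_minus field_simps ge_one_powr_ge_zero)
    finally show "real (T div 2) * \<pi> T \<le> 1 / 2" .
  qed (simp add: \<pi>_def)
  have a1: "1 \<le> a T" if "T \<ge> 1" for T
    using that \<beta> by (simp add: a_def ge_one_powr_ge_zero)
  have ap: "\<pi> T * a T powr p = 1" if "T \<ge> 1" for T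
    using that \<beta>p by (simp add: \<pi>_def a_def powr_powr powr_add[symmetric])
  have a2: "\<pi> T * (a T)\<^sup>2 = real T powr (- 3 * \<beta>)" if "T \<ge> 1" for T
  proof -
    have "(a T)\<^sup>2 = real T powr (1 - 2 * \<beta>)"
      using that by (simp add: a_def power2_eq_square powr_add[symmetric])
    then show ?thesis
      using that by (simp add: \<pi>_def powr_add[symmetric])
  qed
  have aq: "\<pi> T * \<bar>a T\<bar> powr (2 * q) \<le> 1" if "T \<ge> 1" for T
  proof -
    have "\<pi> T * \<bar>a T\<bar> powr (2 * q) \<le> \<pi> T * a T powr p"
      using a1[OF that] assms by (intro mult_left_mono) (auto simp: \<pi>_def intro: powr_mono)
    then show ?thesis using ap[OF that] by simp
  qed
  obtain C where C: "\<And>T. T \<ge> 1 \<Longrightarrow> iterate_moment_cond (step_size \<eta> \<alpha>) q C (M T)"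
  proof (rule iterate_moment_cond_jump_oracle[of \<eta> \<alpha> q])
    fix C assume "\<And>H \<pi> a. rare_jump H \<pi> \<Longrightarrow> \<pi> * \<bar>a\<bar> powr (2 * q) \<le> 1 \<Longrightarrow>
      iterate_moment_cond (step_size \<eta> \<alpha>) q C (jump_oracle \<eta> H \<pi> a)"
    then show thesis
      using rare aq that[of C] unfolding M_def by blast
  qed (use assms in auto)
  \<comment> \<open>The class has one oracle for each horizon; only the oracle for \<open>T\<close> is used at \<open>T\<close>.\<close>
  define \<CC> where "\<CC> = M ` {1..}"
  define G S :: "(nat \<Rightarrow> real) sgd_oracle \<Rightarrow> real" where "G = (\<lambda>_. 1 / \<eta>)" and "S = (\<lambda>_. 0)"
  have "\<CC> \<noteq> {}"
    by (auto simp: \<CC>_def)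
  moreover have "\<forall>M\<in>\<CC>. stochastic_oracle M"
    using rare_jump.stochastic_oracle_jump_oracle[OF rare] by (auto simp: \<CC>_def M_def)
  moreover have "uniform_conditions (step_size \<eta> \<alpha>) p q G S \<CC>"
  proof -
    have "mean_field_cond 1 0 0 (1 / \<eta>) (M T) \<and> noise_moment_cond p 2 (M T) \<and>
        noise_variance_cond 2 \<beta> 0 (M T) \<and> iterate_moment_cond (step_size \<eta> \<alpha>) q C (M T)"
      if T: "T \<ge> 1" for T
    proof (intro conjI)
      interpret rare_jump "T div 2" "\<pi> T" "a T" by (rule rare[OF T])
      show "mean_field_cond 1 0 0 (1 / \<eta>) (M T)"
        unfolding M_def by (rule mean_field_cond_jump_oracle[OF \<open>\<eta> > 0\<close>])
      show "noise_moment_cond p 2 (M T)"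
        unfolding M_def using a1[OF T] ap[OF T] assms
        by (intro noise_moment_cond_jump_oracle) auto
      show "noise_variance_cond 2 \<beta> 0 (M T)"
        unfolding M_def using a2[OF T] T \<beta>
        by (intro noise_variance_cond_jump_oracle[of T]) auto
      show "iterate_moment_cond (step_size \<eta> \<alpha>) q C (M T)"
        by (rule C[OF T])
    qed
    then show ?thesis
      unfolding uniform_conditions_def \<CC>_def G_def S_def using \<beta>(1)
      by (rule_tac x = 1 in exI, rule_tac x = 0 in exI, rule_tac x = 0 in exI, rule_tac x = 2 in exI,
          rule_tac x = 2 in exI, rule_tac x = \<beta> in exI, rule_tac x = C in exI) simp
  qed
  moreover have "\<exists>c>0. \<exists>T0::nat. \<forall>T\<ge>T0.
      worst_case_error N W (step_size \<eta> \<alpha>) G S T \<CC> \<ge> ereal (c * real T powr (- \<beta>))"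
  proof -
    define c where "c = min (1 / 3) (\<eta> / 2)"
    have c: "0 < c" "c \<le> 1 / 3" "c \<le> \<eta> / 2"
      using \<open>\<eta> > 0\<close> by (auto simp: c_def)
    have "filterlim (\<lambda>T. real T powr (1 - \<alpha>)) at_top sequentially"
      using \<open>\<alpha> < 1\<close> by real_asymp
    then have "eventually (\<lambda>T. 2 \<le> real T powr (1 - \<alpha>)) sequentially"
      by (simp add: filterlim_at_top)
    then obtain T1 where T1: "\<And>T. T \<ge> T1 \<Longrightarrow> 2 \<le> real T powr (1 - \<alpha>)"
      by (auto simp: eventually_sequentially)
    have "ereal (c * real T powr (- \<beta>)) \<le> worst_case_error N W (step_size \<eta> \<alpha>) G S T \<CC>"
      if T: "T \<ge> max 2 T1" for T
    proof -
      interpret rare_jump "T div 2" "\<pi> T" "a T" using rare T by simp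
      let ?r = "c * real T powr (- \<beta>)"
      let ?X = "sgd_path (step_size \<eta> \<alpha>) T (M T)"
      have "ereal ?r \<le> prokhorov_dist (distr (prob_measure (M T)) skorokhod_borel ?X)
          (distr N skorokhod_borel (\<lambda>_. zero_path))"
      proof (rule prokhorov_dist_point_mass_ge)
        show "prob_space (prob_measure (M T))"
          by (simp add: M_def measure_pmf.prob_space_axioms)
        show "prob_space N"
          using assms(1) by (simp add: standard_brownian_motion_def)
        \<comment> \<open>At most the path without a jump stays below the threshold.\<close>
        have large: "?r \<le> \<bar>?X (jump_path (a T) k) 1\<bar>"
          if k: "k \<in> set_pmf (jump_index (T div 2) (\<pi> T))" "k \<noteq> 0" for k
        proof -
          have size: "a T / sqrt (real T) = real T powr (- \<beta>)"
            using T by (simp add: a_def powr_half_sqrt[symmetric] powr_diff[symmetric])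
          have "?r \<le> \<eta> / 2 * (a T / sqrt (real T))"
            unfolding size using c by (intro mult_right_mono) auto
          also have "\<dots> \<le> \<bar>?X (jump_path (a T) k) 1\<bar>"
            unfolding M_def using assms k set_jump_index T T1 a1[of T]
            by (intro jump_moves_path) force+
          finally show ?thesis .
        qed
        have "T \<le> 3 * (T div 2)"
          using T by presburger
        then have "real T \<le> 3 * real (T div 2)"
          by linarith
        moreover have "c * real T \<le> 1 / 3 * real T"
          using c by (intro mult_right_mono) auto
        ultimately have "c * real T \<le> real (T div 2)"
          by linarith
        then have "c * real T * \<pi> T \<le> real (T div 2) * \<pi> T"
          by (rule mult_right_mono) (simp add: \<pi>_def)
        then have "?r \<le> real (T div 2) * \<pi> T"
          using T by (simp add: \<pi>_def powr_diff)
        also have "\<dots> = 1 - pmf (jump_index (T div 2) (\<pi> T)) 0"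
          by (simp add: pmf_jump_index)
        also have "\<dots> = measure (jump_index (T div 2) (\<pi> T)) (UNIV - {0})"
          using measure_pmf.prob_compl[of "{0}" "jump_index (T div 2) (\<pi> T)"]
          by (simp add: pmf.rep_eq)
        also have "\<dots> \<le> measure (jump_index (T div 2) (\<pi> T)) {k. ?r \<le> \<bar>?X (jump_path (a T) k) 1\<bar>}"
          by (rule measure_pmf.finite_measure_mono_AE) (auto simp: AE_measure_pmf_iff large)
        finally show "?r \<le> measure (prob_measure (M T)) {\<omega> \<in> space (prob_measure (M T)). ?r \<le> \<bar>?X \<omega> 1\<bar>}"
          by (simp add: M_def jump_law_def vimage_def)
      qed (auto simp: M_def)
      also have "(\<lambda>_. zero_path) = target_path W (G (M T)) (S (M T))"
        by (auto simp: target_path_def S_def zero_path_def)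
      finally show ?thesis
        unfolding worst_case_error_def \<CC>_def using T by (intro SUP_upper2[of "M T"]) auto
    qed
    then show ?thesis
      using c(1) by blast
  qed
  ultimately show ?thesis
    unfolding \<beta>_def by blast
qed

end
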